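(* For each integer $n\ge 0$ let \[ M_n(s)=\int_0^1 x^{s-1}\,U_n(x)\,\frac{dx}{(1-x^2)^{1/4}}, \] (for $\Re s>0$ when $n$ is even and $\Re s>-1$ when $n$ is odd), where $U_n$ is the Chebyshev polynomial of the second kind, and let $\varepsilon=0$ if $n$ is even, $\varepsilon=1$ if $n$ is odd. Define $p_n(s)$ by \[ M_n(s)=p_n(s)\,\frac{\Gamma\left(\frac{s+\varepsilon}{2}\right)}{\Gamma\left(\frac{s}{2}+\frac{2n+3}{4}\right)}. \] Then: (a) $p_0=\Gamma(3/4)/2$, $p_1=\Gamma(3/4)$, and for $n\ge 2$ even, \[ p_n(s)=s\,p_{n-1}(s+1)-\tfrac12\left(s+n-\tfrac12\right)p_{n-2}(s), \] while for $n\ge 3$ odd, \[ p_n(s)=2\,p_{n-1}(s+1)-\tfrac12\left(s+n-\tfrac12\right)p_{n-2}(s). \] (b) Each $p_n(s)$ is a polynomial in $s$ of degree $\lfloor n/2\rfloor$ satisfying the functional equation $p_n(s)=(-1)^{\lfloor n/2\rfloor}p_n(1-s)$. All zeros of $p_n$ lie on the critical line $\Re s=1/2$, and all zeros different from $1/2$ occur in complex conjugate pairs.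
   Context: $U_n$ denotes the Chebyshev polynomial of the second kind, $U_n(\cos\theta)=\sin((n+1)\theta)/\sin\theta$. The identity defining $p_n$ is understood via analytic continuation of the Gamma function, so $p_n$ is defined for all complex $s$. *)

theory Defs
  imports "HOL-Complex_Analysis.Complex_Analysis" "HOL-Computational_Algebra.Polynomial"
begin

definition cheb_U :: "nat \<Rightarrow> real poly" where
  "cheb_U n = (THE q. \<forall>\<theta>. sin \<theta> \<noteq> 0 \<longrightarrow>
     poly q (cos \<theta>) = sin ((real n + 1) * \<theta>) / sin \<theta>)"

lemma cheb_U_unique:
  fixes q r :: "real poly"
  assumes "\<forall>\<theta>. sin \<theta> \<noteq> 0 \<longrightarrow> poly q (cos \<theta>) = F \<theta>"
    and "\<forall>\<theta>. sin \<theta> \<noteq> 0 \<longrightarrow> poly r (cos \<theta>) = F \<theta>"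
  shows "q = r"
proof (rule ccontr)
  assume "q \<noteq> r"
  then have "finite {x. poly (q - r) x = 0}"
    by (intro poly_roots_finite) simp
  moreover have "{-1<..<1} \<subseteq> {x. poly (q - r) x = 0}"
  proof
    fix x :: real assume x: "x \<in> {-1<..<1}"
    then have "cos (arccos x) = x" "sin (arccos x) \<noteq> 0"
      by (auto simp: sin_arccos_nonzero)
    then have "poly q x = F (arccos x)" "poly r x = F (arccos x)"
      using assms by metis+
    then show "x \<in> {x. poly (q - r) x = 0}" by simp
  qed
  ultimately have "finite {-1<..<(1::real)}"
    using finite_subset by blast
  then show False by (simp add: infinite_Ioo)
qed

lemma cheb_U_exists:
  "\<exists>q::real poly. \<forall>\<theta>. sin \<theta> \<noteq> 0 \<longrightarrow>
     poly q (cos \<theta>) = sin ((real n + 1) * \<theta>) / sin \<theta>"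
proof (induction n rule: less_induct)
  case (less n)
  consider "n = 0" | "n = 1" | k where "n = k + 2"
    by (metis One_nat_def add_2_eq_Suc' not0_implies_Suc)
  then show ?case
  proof cases
    case 1
    then show ?thesis by (intro exI[of _ 1]) simp
  next
    case 2
    then show ?thesis by (intro exI[of _ "[:0, 2:]"]) (simp add: sin_double)
  next
    case 3
    obtain q where q: "\<And>\<theta>. sin \<theta> \<noteq> 0 \<Longrightarrow> poly q (cos \<theta>) = sin ((real (k+1) + 1) * \<theta>) / sin \<theta>"
      using less[of "k+1"] 3 by auto
    obtain r where r: "\<And>\<theta>. sin \<theta> \<noteq> 0 \<Longrightarrow> poly r (cos \<theta>) = sin ((real k + 1) * \<theta>) / sin \<theta>"
      using less[of k] 3 by auto
    have "poly ([:0, 2:] * q - r) (cos \<theta>) = sin ((real n + 1) * \<theta>) / sin \<theta>"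
      if "sin \<theta> \<noteq> 0" for \<theta>
    proof -
      have "sin ((real n + 1) * \<theta>) = sin ((real k + 2) * \<theta> + \<theta>)"
           "sin ((real k + 1) * \<theta>) = sin ((real k + 2) * \<theta> - \<theta>)"
        using 3 by (simp_all add: algebra_simps)
      then have "sin ((real n + 1) * \<theta>) = 2 * cos \<theta> * sin ((real k + 2) * \<theta>) - sin ((real k + 1) * \<theta>)"
        by (simp add: sin_add sin_diff)
      with q[OF that] r[OF that] show ?thesis
        by (simp add: diff_divide_distrib add.commute)
    qed
    then show ?thesis by blast
  qed
qed

lemma poly_cheb_U:
  assumes "sin \<theta> \<noteq> 0"
  shows "poly (cheb_U n) (cos \<theta>) = sin ((real n + 1) * \<theta>) / sin \<theta>"
proof -
  have "\<exists>!q::real poly. \<forall>\<theta>. sin \<theta> \<noteq> 0 \<longrightarrow>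
     poly q (cos \<theta>) = sin ((real n + 1) * \<theta>) / sin \<theta>"
    using cheb_U_exists[of n] cheb_U_unique by (intro ex_ex1I) auto
  from theI'[OF this] assms show ?thesis
    unfolding cheb_U_def by blast
qed

definition parity :: "nat \<Rightarrow> nat" where
  "parity n = (if even n then 0 else 1)"

definition mellin_integrand :: "nat \<Rightarrow> complex \<Rightarrow> real \<Rightarrow> complex" where
  "mellin_integrand n s x =
     complex_of_real x powr (s - 1) * complex_of_real (poly (cheb_U n) x) /
     complex_of_real ((1 - x\<^sup>2) powr (1/4))"

definition mellin_U :: "nat \<Rightarrow> complex \<Rightarrow> complex" where
  "mellin_U n s = (LBINT x:{0<..<1}. mellin_integrand n s x)"

definition gamma_factor :: "nat \<Rightarrow> complex \<Rightarrow> complex" where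
  "gamma_factor n s =
     Gamma ((s + of_nat (parity n)) / 2) / Gamma (s / 2 + (2 * of_nat n + 3) / 4)"

text \<open>
  The integral converges only for \<open>Re s > - parity n\<close>, so the defining identity is imposed on
  that half-plane, where neither Gamma function has a pole, and \<open>mellin_p n\<close> is its analytic
  continuation to the whole plane. Continuations are unique by the identity theorem; existence
  is not presupposed (if it failed, the description below would be unspecified).
\<close>

definition mellin_p :: "nat \<Rightarrow> complex \<Rightarrow> complex" where
  "mellin_p n = (THE f. f holomorphic_on UNIV \<and>
     (\<forall>s. Re s > - real (parity n) \<longrightarrow> mellin_U n s = f s * gamma_factor n s))"

end

theory Submission
  imports Defs "HOL-Computational_Algebra.Fundamental_Theorem_Algebra"
begin

text \<open>
  The three-term recurrence of \<open>U\<^sub>n\<close> turns into the recurrence for \<open>p\<^sub>n\<close> under the Mellin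
  transform; it only remains to evaluate \<open>M\<^sub>0\<close>, a Beta integral with complex first argument,
  which is obtained from the real case by analytic continuation of the series
  \<open>\<Sum>\<^sub>k (c)\<^sub>k / (k! (z + k)) = B(z, 1 - c)\<close>.

  Write \<open>t = s - 1/2\<close>. The recurrence implies the difference identities
  \<open>(t + 1/2) p\<^sub>n\<^sub>-\<^sub>1(s + 1) - (t - 1/2) p\<^sub>n\<^sub>-\<^sub>1(s - 1) = n p\<^sub>n\<^sub>-\<^sub>2(s)\<close> for even \<open>n\<close> and
  \<open>2 p\<^sub>n\<^sub>-\<^sub>1(s + 1) - 2 p\<^sub>n\<^sub>-\<^sub>1(s - 1) = n p\<^sub>n\<^sub>-\<^sub>2(s)\<close> for odd \<open>n\<close>. They give a reflected
  recurrence, hence the functional equation, and, with \<open>E\<close> and \<open>F\<close> the two terms on the left,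
  \<open>2n p\<^sub>n = (n - t) E + (n + t) F\<close>. If the zeros of \<open>p\<^sub>n\<^sub>-\<^sub>1\<close> lie on the critical line, then
  \<open>E = \<Prod>(t - i b + a)\<close> and \<open>F = \<Prod>(t - i b - a)\<close> up to a common constant, with \<open>a > 0\<close>,
  and the Cayley transform \<open>W = (E + F) / (E - F)\<close> satisfies \<open>Re W \<ge> Re t / \<Sum>a\<close> for
  \<open>Re t > 0\<close>. A zero of \<open>p\<^sub>n\<close> there would force \<open>W = t / n\<close>, which is impossible because
  \<open>\<Sum>a < n\<close>.
\<close>

section \<open>Recurrence and functional equation\<close>

text \<open>Candidates for p_n. The index is raised by two against the recurrence of the theorem, so
  that s + n - 1/2 becomes s + n + 3/2.\<close>

fun mellin_poly :: "nat \<Rightarrow> complex poly" where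
  "mellin_poly 0 = [:Gamma (3/4) / 2:]"
| "mellin_poly (Suc 0) = [:Gamma (3/4):]"
| "mellin_poly (Suc (Suc n)) =
     (if even n then [:0, 1:] else [:2:]) * pcompose (mellin_poly (Suc n)) [:1, 1:]
     - smult (1/2) ([:of_nat n + 3/2, 1:] * mellin_poly n)"

lemma mellin_poly_even_step:
  "even n \<Longrightarrow> poly (mellin_poly (Suc (Suc n))) s =
     s * poly (mellin_poly (Suc n)) (s + 1) - 1/2 * (s + of_nat n + 3/2) * poly (mellin_poly n) s"
  by (simp add: poly_pcompose algebra_simps)

lemma mellin_poly_odd_step:
  "odd n \<Longrightarrow> poly (mellin_poly (Suc (Suc n))) s =
     2 * poly (mellin_poly (Suc n)) (s + 1) - 1/2 * (s + of_nat n + 3/2) * poly (mellin_poly n) s"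
  by (simp add: poly_pcompose algebra_simps)

text \<open>Merges the multipliers s and 2 of the two recurrences, so that one identity serves both
  parities.\<close>

definition shift_factor :: "nat \<Rightarrow> complex \<Rightarrow> complex" where
  "shift_factor n t = (if even n then t else 2)"

text \<open>Both recurrences at once, doubled to clear denominators and written in s - 1/2, which
  changes sign under s -> 1 - s.\<close>

lemma mellin_poly_forward:
  "2 * poly (mellin_poly (Suc (Suc n))) s =
     2 * shift_factor n s * poly (mellin_poly (Suc n)) (s + 1)
     - (s - 1/2 + (of_nat n + 2)) * poly (mellin_poly n) s"
proof (cases "even n")
  case True
  show ?thesis unfolding mellin_poly_even_step[OF True]
    using True by (simp add: shift_factor_def field_simps)
next
  case False
  show ?thesis unfolding mellin_poly_odd_step[OF False]
    using False by (simp add: shift_factor_def field_simps)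
qed

declare mellin_poly.simps(3) [simp del]

text \<open>Strong induction: the hypothesis at s + 1 and s - 1 removes the values at s + 2 and s -
  2, and combining the forward and the backward recurrence at s removes the term of lowest
  index.\<close>

lemma mellin_poly_difference:
  "shift_factor n s * poly (mellin_poly (Suc n)) (s + 1)
     - shift_factor n (s - 1) * poly (mellin_poly (Suc n)) (s - 1)
     = (of_nat n + 2) * poly (mellin_poly n) s"
proof (induction n arbitrary: s rule: less_induct)
  case (less n)
  consider "n = 0" | "n = 1" | k where "n = Suc (Suc k)"
    by (metis One_nat_def not0_implies_Suc)
  then show ?case
  proof cases
    case 1
    then show ?thesis by (simp add: shift_factor_def algebra_simps)
  next
    case 2
    then show ?thesis
      by (simp add: shift_factor_def mellin_poly_even_step[of 0, simplified])
         (simp add: algebra_simps add_divide_distrib)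
  next
    case 3
    \<comment> \<open>Inserting the difference identity into the forward recurrence reflects it.
      Within the induction this is available only below \<open>n\<close>.\<close>
    have backw: "2 * poly (mellin_poly (Suc (Suc m))) z =
       2 * shift_factor m (z - 1) * poly (mellin_poly (Suc m)) (z - 1)
       + (of_nat m + 2 - (z - 1/2)) * poly (mellin_poly m) z" if "m < n" for m z
      using mellin_poly_forward[of m z] less.IH[OF that, of z] by algebra
    have k: "k < n" "Suc k < n" using 3 by auto
    have e: "s + 1 + 1 = s + 2" "s - 1 - 1 = s - 2" "s + 1 - 1 = s" "s - 1 + 1 = s" by simp_all
    note f = mellin_poly_forward[of "Suc k" "s + 1"] backw[OF k(2), of "s - 1"]
       less.IH[OF k(2), of "s + 1"] less.IH[OF k(2), of "s - 1"]
       mellin_poly_forward[of k s] backw[OF k(1), of s]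
    note f = f[unfolded e of_nat_Suc]
    show ?thesis
    proof (cases "even k")
      case True
      then have sf: "shift_factor k z = z" "shift_factor (Suc k) z = 2" "shift_factor (Suc (Suc k)) z = z" for z
        by (simp_all add: shift_factor_def)
      show ?thesis using f unfolding 3 of_nat_Suc sf by algebra
    next
      case False
      then have sf: "shift_factor k z = 2" "shift_factor (Suc k) z = z" "shift_factor (Suc (Suc k)) z = 2" for z
        by (simp_all add: shift_factor_def)
      show ?thesis using f unfolding 3 of_nat_Suc sf by algebra
    qed
  qed
qed

lemma mellin_poly_backward:
  "2 * poly (mellin_poly (Suc (Suc n))) s =
     2 * shift_factor n (s - 1) * poly (mellin_poly (Suc n)) (s - 1)
     + (of_nat n + 2 - (s - 1/2)) * poly (mellin_poly n) s"
  using mellin_poly_forward[of n s] mellin_poly_difference[of n s] by algebra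

text \<open>Replacing s by 1 - s turns the forward recurrence into the backward one up to sign. In
  the step from k to k + 2 the sign comes from the factor 1 - s when k is even and from
  \<open>Suc k div 2 = Suc (k div 2)\<close> when k is odd.\<close>

lemma mellin_poly_functional_equation:
  "poly (mellin_poly n) (1 - s) = (-1) ^ (n div 2) * poly (mellin_poly n) s"
proof (induction n arbitrary: s rule: less_induct)
  case (less n)
  consider "n = 0" | "n = 1" | k where "n = Suc (Suc k)"
    by (metis One_nat_def not0_implies_Suc)
  then show ?case
  proof cases
    case 3
    have IH: "poly (mellin_poly k) (1 - s) = (-1) ^ (k div 2) * poly (mellin_poly k) s"
      "poly (mellin_poly (Suc k)) (1 - s + 1) = (-1) ^ (Suc k div 2) * poly (mellin_poly (Suc k)) (s - 1)"
      using less[of k s] less[of "Suc k" "s - 1"] 3 by (simp_all add: algebra_simps)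
    define a :: complex where "a = (-1) ^ (k div 2)"
    note eqs = mellin_poly_forward[of k "1 - s"] mellin_poly_backward[of k s]
    have "2 * poly (mellin_poly n) (1 - s) = 2 * ((-1) ^ (n div 2) * poly (mellin_poly n) s)"
    proof (cases "even k")
      case True
      then have p: "(-1) ^ (Suc k div 2) = a" "(-1) ^ (n div 2) = - a"
        and sf: "shift_factor k z = z" for z
        by (simp_all add: a_def 3 shift_factor_def)
      show ?thesis
        using eqs IH unfolding p sf a_def[symmetric] unfolding 3 by algebra
    next
      case False
      then have "Suc k div 2 = Suc (k div 2)" by presburger
      then have p: "(-1) ^ (Suc k div 2) = - a" "(-1) ^ (n div 2) = - a"
        and sf: "shift_factor k z = 2" for z
        using False by (simp_all add: a_def 3 shift_factor_def)
      show ?thesis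
        using eqs IH unfolding p sf a_def[symmetric] unfolding 3 by algebra
    qed
    then show ?thesis by simp
  qed simp_all
qed

section \<open>Zeros on the critical line\<close>

text \<open>Superadditivity of the parallel sum; multiplying the
  factors of \<open>E\<close> and \<open>F\<close> combines their Cayley transforms to \<open>(1 + V W) / (V + W)\<close>, so this makes the lower bounds \<open>Re t / a\<close> combine to \<open>Re t / \<Sum>a\<close>.\<close>

lemma Re_parallel_sum_ge:
  fixes v w :: complex
  assumes "Re v > 0" "Re w > 0"
  shows "Re (v * w / (v + w)) \<ge> Re v * Re w / (Re v + Re w)"
proof -
  obtain a b c d where [simp]: "v = Complex a b" "w = Complex c d"
    by (meson complex.exhaust)
  have pos: "a > 0" "c > 0" using assms by auto
  have "Re (v * w / (v + w)) = (a * c * (a + c) + b\<^sup>2 * c + d\<^sup>2 * a) / ((a + c)\<^sup>2 + (b + d)\<^sup>2)"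
    by (simp add: Re_divide power2_eq_square algebra_simps)
  moreover have "a * c * ((a + c)\<^sup>2 + (b + d)\<^sup>2) \<le> (a * c * (a + c) + b\<^sup>2 * c + d\<^sup>2 * a) * (a + c)"
    \<comment> \<open>The right side minus the left side is exactly this square.\<close>
    using zero_le_power2[of "b * c - d * a"]
    by (simp add: power2_eq_square algebra_simps)
  moreover have "(a + c)\<^sup>2 + (b + d)\<^sup>2 > 0"
    using pos by (intro add_pos_nonneg) auto
  ultimately show ?thesis using pos by (simp add: divide_le_eq le_divide_eq)
qed

text \<open>Induction on the list. A single factor has transform (t - i b) / a, with real part Re t
  / a. A further factor with transform V replaces W by V W / (V + W) + 1 / (V + W); the first term
  is bounded below by the parallel sum of the real parts, the second has positive real part.\<close>

lemma shifted_product_Cayley: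
  fixes t :: complex and xs :: "(real \<times> real) list"
  assumes "xs \<noteq> []" "\<And>a b. (a, b) \<in> set xs \<Longrightarrow> a > 0" "Re t > 0"
  defines "E \<equiv> (\<Prod>(a, b)\<leftarrow>xs. t - \<i> * of_real b + of_real a)"
    and "F \<equiv> (\<Prod>(a, b)\<leftarrow>xs. t - \<i> * of_real b - of_real a)"
  shows "\<exists>W. E \<noteq> 0 \<and> Re W \<ge> Re t / (\<Sum>(a, b)\<leftarrow>xs. a) \<and> (\<Sum>(a, b)\<leftarrow>xs. a) > 0 \<and> F * (W + 1) = E * (W - 1)"
  using assms(1,2) unfolding E_def F_def
proof (induction xs rule: list_nonempty_induct)
  case (single x)
  obtain a b where x: "x = (a, b)" by fastforce
  have a: "a > 0" using single x by auto
  have "t - \<i> * of_real b + of_real a \<noteq> 0"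
    using a assms(3) by (auto simp: complex_eq_iff)
  then show ?case
    using a by (intro exI[of _ "(t - \<i> * of_real b) / of_real a"]) (simp add: x field_simps)
next
  case (cons x xs)
  obtain a b where x: "x = (a, b)" by fastforce
  have a: "a > 0" using cons x by auto
  define E F S where "E = (\<Prod>(a, b)\<leftarrow>xs. t - \<i> * of_real b + of_real a)"
    and "F = (\<Prod>(a, b)\<leftarrow>xs. t - \<i> * of_real b - of_real a)" and "S = (\<Sum>(a, b)\<leftarrow>xs. a)"
  obtain W where W: "E \<noteq> 0" "Re W \<ge> Re t / S" "S > 0" "F * (W + 1) = E * (W - 1)"
    using cons by (auto simp: E_def F_def S_def)
  define z where "z = t - \<i> * of_real b"
  define V where "V = z / of_real a"
  have V: "Re V = Re t / a" by (simp add: V_def z_def)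
  have z: "z = of_real a * V" using a by (simp add: V_def)
  have ne: "z + of_real a \<noteq> 0"
    using a assms(3) by (auto simp: complex_eq_iff z_def)
  have pos: "Re V > 0" "Re W > 0" using V W a assms(3)
    by (simp, metis divide_pos_pos less_le_trans)
  have VW: "V + W \<noteq> 0" using pos by (auto simp: complex_eq_iff)
  \<comment> \<open>The target is the parallel sum of the two known lower bounds, and the parallel
    sum is monotone in both arguments.\<close>
  have "Re t / (a + S) = 1 / (1 / (Re t / a) + 1 / (Re t / S))"
    using a W(3) assms(3) by (simp add: field_simps)
  also have "\<dots> \<le> 1 / (1 / Re V + 1 / Re W)"
    using W pos a assms(3) V by (intro divide_left_mono add_mono mult_pos_pos add_pos_pos) auto
  also have "\<dots> = Re V * Re W / (Re V + Re W)"
    using pos by (simp add: field_simps)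
  also have "\<dots> \<le> Re (V * W / (V + W))"
    using Re_parallel_sum_ge[OF pos] .
  also have "\<dots> \<le> Re (V * W / (V + W)) + Re (1 / (V + W))"
    using pos by (simp add: Re_divide)
  also have "\<dots> = Re ((1 + V * W) / (V + W))"
    by (simp add: add_divide_distrib)
  finally have Re: "Re t / (a + S) \<le> Re ((1 + V * W) / (V + W))" .
  \<comment> \<open>Adding or subtracting 1 factors the new transform: the numerators become (V + 1)
    (W + 1) and (V - 1) (W - 1).\<close>
  have "(z - of_real a) * F * ((1 + V * W) / (V + W) + 1) = of_real a * (V - 1) * (V + 1) * (F * (W + 1)) / (V + W)"
    using VW by (simp add: z field_simps)
  also have "\<dots> = (z + of_real a) * E * ((1 + V * W) / (V + W) - 1)"
    unfolding W(4) using VW by (simp add: z field_simps)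
  finally show ?case
    using ne W(1,3) a Re
    by (intro exI[of _ "(1 + V * W) / (V + W)"])
       (simp add: x E_def[symmetric] F_def[symmetric] S_def[symmetric] z_def[symmetric])
qed

lemma shifted_product_no_zero:
  fixes t :: complex and xs :: "(real \<times> real) list"
  assumes "xs \<noteq> []" "\<And>a b. (a, b) \<in> set xs \<Longrightarrow> a > 0" "Re t > 0" "(\<Sum>(a, b)\<leftarrow>xs. a) < k"
  defines "E \<equiv> (\<Prod>(a, b)\<leftarrow>xs. t - \<i> * of_real b + of_real a)"
    and "F \<equiv> (\<Prod>(a, b)\<leftarrow>xs. t - \<i> * of_real b - of_real a)"
  shows "(of_real k - t) * E + (of_real k + t) * F \<noteq> 0"
proof
  assume eq: "(of_real k - t) * E + (of_real k + t) * F = 0"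
  define S where "S = (\<Sum>(a, b)\<leftarrow>xs. a)"
  obtain W where W: "E \<noteq> 0" "Re W \<ge> Re t / S" "S > 0" "F * (W + 1) = E * (W - 1)"
    using shifted_product_Cayley[OF assms(1) _ assms(3)] assms(2) unfolding E_def F_def S_def by blast
  \<comment> \<open>Multiply the assumed equation by W + 1 and replace F (W + 1) by E (W -
    1).\<close>
  have "2 * E * (of_real k * W - t) = 0"
    using eq W(4) by algebra
  then have "t = of_real k * W" using W(1) by simp
  then have "Re t = k * Re W" by simp
  moreover have "k * Re W \<ge> k * (Re t / S)"
    using W assms(4) by (intro mult_left_mono) (auto simp: S_def)
  moreover have "k * (Re t / S) > Re t"
    using W assms(3,4) by (simp add: S_def field_simps)
  ultimately show False by simp
qed

section \<open>Degree and leading coefficient\<close>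

lemma Gamma_three_quarters_nonzero: "Gamma (3/4 :: complex) \<noteq> 0"
  using Gamma_complex_of_real[of "3/4"] Gamma_real_pos[of "3/4"]
  by (metis of_real_eq_0_iff of_real_divide of_real_numeral less_irrefl zero_less_divide_iff zero_less_numeral)

text \<open>Both terms of the recurrence have the same degree, so the exact leading coefficients are
  carried along to exclude cancellation: 2 (n + 2) - (n + 1) = n + 3 is nonzero.\<close>

lemma degree_lead_coeff_mellin_poly:
  "degree (mellin_poly n) = n div 2 \<and>
   lead_coeff (mellin_poly n) = Gamma (3/4) * (of_nat n + 1) / 2 ^ (n div 2 + 1)"
proof (induction n rule: mellin_poly.induct)
  case 1
  then show ?case by simp
next
  case 2
  then show ?case by simp
next
  case (3 n)
  define m where "m = Suc (n div 2)"
  define p where "p = (if even n then [:0, 1:] else [:2:]) * pcompose (mellin_poly (Suc n)) [:1, 1:]"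
  define q where "q = smult (1/2) ([:of_nat n + 3/2, 1:] * mellin_poly n)"
  have ne: "of_nat n + 1 \<noteq> (0 :: complex)" "of_nat n + 2 \<noteq> (0 :: complex)" "of_nat n + 3 \<noteq> (0 :: complex)"
    using of_nat_neq_0[where ?'a = complex, of n] of_nat_neq_0[where ?'a = complex, of "n + 1"]
      of_nat_neq_0[where ?'a = complex, of "n + 2"] by (simp_all add: add_ac)
  note IH1 = conjunct1[OF 3(1)] conjunct2[OF 3(1)] and IH2 = conjunct1[OF 3(2)] conjunct2[OF 3(2)]
  have nz: "mellin_poly (Suc n) \<noteq> 0" "mellin_poly n \<noteq> 0"
    using IH1(2) IH2(2) ne Gamma_three_quarters_nonzero by (auto simp: add_ac)
  have pc: "degree (pcompose (mellin_poly (Suc n)) [:1, 1:]) = Suc n div 2"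
    "lead_coeff (pcompose (mellin_poly (Suc n)) [:1, 1:]) = lead_coeff (mellin_poly (Suc n))"
    using IH1(1) lead_coeff_comp[of "[:1, 1:]" "mellin_poly (Suc n)"] by (simp_all add: degree_pcompose)
  then have pc0: "pcompose (mellin_poly (Suc n)) [:1, 1:] \<noteq> 0"
    using nz by auto
  have p: "degree p = m" "lead_coeff p = Gamma (3/4) * (of_nat n + 2) / 2 ^ m"
  proof -
    have "degree p = m \<and> lead_coeff p = Gamma (3/4) * (of_nat n + 2) / 2 ^ m"
    proof (cases "even n")
      case True
      have "degree p = degree [:0, 1 :: complex:] + Suc n div 2"
        unfolding p_def using True pc0 pc(1) by (simp only: if_True, subst degree_mult_eq) auto
      moreover have "lead_coeff p = lead_coeff (mellin_poly (Suc n))"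
        unfolding p_def using True pc(2) by (simp only: if_True lead_coeff_mult) simp
      ultimately show ?thesis using IH1(2) True by (simp add: m_def add_ac)
    next
      case False
      then have "Suc n div 2 = m" unfolding m_def by presburger
      moreover have "degree p = degree [:2 :: complex:] + Suc n div 2"
        unfolding p_def using False pc0 pc(1) by (simp only: if_False, subst degree_mult_eq) auto
      moreover have "lead_coeff p = 2 * lead_coeff (mellin_poly (Suc n))"
        unfolding p_def using False pc(2) by (simp only: if_False lead_coeff_mult) simp
      ultimately show ?thesis using IH1(2) by (simp add: add_ac)
    qed
    then show "degree p = m" "lead_coeff p = Gamma (3/4) * (of_nat n + 2) / 2 ^ m" by auto
  qed
  have q: "degree q = m" "lead_coeff q = Gamma (3/4) * (of_nat n + 1) / 2 ^ (m + 1)"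
  proof -
    have "degree q = degree [:of_nat n + 3/2, 1 :: complex:] + n div 2"
      unfolding q_def using nz IH2(1) by (subst degree_smult_eq, subst degree_mult_eq) auto
    then show "degree q = m" by (simp add: m_def)
    have "lead_coeff q = lead_coeff (mellin_poly n) / 2"
      unfolding q_def by (simp only: lead_coeff_smult lead_coeff_mult) simp
    then show "lead_coeff q = Gamma (3/4) * (of_nat n + 1) / 2 ^ (m + 1)"
      by (simp add: IH2(2) m_def)
  qed
  have eq: "mellin_poly (Suc (Suc n)) = p - q"
    by (simp add: p_def q_def mellin_poly.simps)
  have c: "coeff (p - q) m = Gamma (3/4) * (of_nat (Suc (Suc n)) + 1) / 2 ^ (m + 1)"
    using p q by (simp add: field_simps)
  have "coeff (p - q) m \<noteq> 0"
    unfolding c using ne(3) Gamma_three_quarters_nonzero by (simp add: add_ac)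
  moreover have "degree (p - q) \<le> m" using p q by (metis degree_diff_le order_refl)
  ultimately have "degree (p - q) = m" by (meson le_antisym le_degree)
  then show ?case unfolding eq using c by (simp add: m_def)
qed

section \<open>Reflection and multiplicities of zeros\<close>

lemma poly_eqI_complex:
  fixes p q :: "complex poly"
  shows "(\<And>x. poly p x = poly q x) \<Longrightarrow> p = q"
  by (simp add: poly_eq_poly_eq_iff[symmetric] fun_eq_iff)

lemma pcompose_power: "pcompose (p ^ n) q = pcompose p q ^ n"
  for p q :: "'a :: comm_semiring_1 poly"
  by (induction n) (simp_all add: pcompose_mult pcompose_1)

text \<open>Substituting c - X for X turns the factor X - a into -(X - (c - a)), so every power of
  it dividing p is carried over to c - a.\<close>

lemma order_pcompose_reflect_le:
  fixes p :: "complex poly"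
  assumes "p \<noteq> 0"
  shows "order a p \<le> order (c - a) (pcompose p [:c, -1:])"
proof -
  have "[:- a, 1:] ^ order a p dvd p" by (rule order_1)
  then obtain r where r: "p = [:- a, 1:] ^ order a p * r" by (elim dvdE)
  have "pcompose p [:c, -1:] = pcompose [:- a, 1:] [:c, -1:] ^ order a p * pcompose r [:c, -1:]"
    by (subst r) (simp only: pcompose_mult pcompose_power)
  also have "pcompose [:- a, 1:] [:c, -1:] = smult (-1) [:- (c - a), 1:]"
    by (simp add: pcompose_pCons)
  also have "smult (-1) [:- (c - a), 1:] ^ order a p * pcompose r [:c, -1:] =
    [:- (c - a), 1:] ^ order a p * smult ((-1) ^ order a p) (pcompose r [:c, -1:])"
    by (simp only: smult_power mult_smult_left mult_smult_right)
  finally have "[:- (c - a), 1:] ^ order a p dvd pcompose p [:c, -1:]"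
    by (metis dvd_triv_left)
  moreover have "pcompose p [:c, -1:] \<noteq> 0"
    using assms by (simp add: pcompose_eq_0_iff)
  ultimately show ?thesis by (subst (asm) order_divides) auto
qed

lemma mellin_poly_nonzero: "mellin_poly n \<noteq> 0"
  using degree_lead_coeff_mellin_poly[of n] Gamma_three_quarters_nonzero of_nat_neq_0[where ?'a = complex, of n]
  by (auto simp: add_ac)

lemma mellin_poly_reflect:
  "pcompose (mellin_poly n) [:1, -1:] = smult ((-1) ^ (n div 2)) (mellin_poly n)"
  by (rule poly_eqI_complex) (simp add: poly_pcompose mellin_poly_functional_equation)

lemma order_mellin_poly_reflect: "order (1 - s) (mellin_poly n) = order s (mellin_poly n)"
proof -
  \<comment> \<open>Reflection is an involution, so this inequality at s and at 1 - s gives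
    equality.\<close>
  have "order z (mellin_poly n) \<le> order (1 - z) (mellin_poly n)" for z
    using order_pcompose_reflect_le[OF mellin_poly_nonzero, of z n 1]
    by (simp add: mellin_poly_reflect order_smult)
  from this[of s] this[of "1 - s"] show ?thesis by simp
qed

section \<open>Location of the zeros\<close>

text \<open>Induction: the zeros of the preceding polynomial lie on the line, which gives E and F
  the shape needed for \<open>shifted_product_no_zero\<close>. This excludes zeros with Re > 1/2;
  the functional equation then excludes the other side.\<close>

lemma mellin_poly_zeros: "poly (mellin_poly n) s = 0 \<Longrightarrow> Re s = 1/2"
proof (induction n arbitrary: s)
  case 0
  then show ?case using Gamma_three_quarters_nonzero by simp
next
  case (Suc n)
  show ?case
  proof (cases n)
    case 0
    then show ?thesis using Suc.prems Gamma_three_quarters_nonzero by simp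
  next
    case (Suc k)
    define p where "p = mellin_poly n"
    obtain rs where rs: "p = smult (lead_coeff p) (\<Prod>x\<in>#mset rs. [:- x, 1:])" "length rs = degree p"
      using alg_closed_imp_factorization[of p] mellin_poly_nonzero[of n] unfolding p_def
      by (metis ex_mset size_mset)
    have lc: "lead_coeff p \<noteq> 0" using mellin_poly_nonzero by (simp add: p_def)
    have ev: "poly p z = lead_coeff p * (\<Prod>r\<leftarrow>rs. z - r)" for z
      by (subst rs(1)) (simp add: poly_prod_mset prod_mset_prod_list image_mset.compositionality o_def flip: prod_mset_prod_list)
    have re: "Re r = 1/2" if "r \<in> set rs" for r
    proof -
      have "poly p r = 0" using that unfolding ev by (auto simp: prod_list_zero_iff)
      then show ?thesis using Suc.IH by (simp add: p_def)
    qed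
    \<comment> \<open>A root r of p contributes z \<plusminus> 1 - r = t - i Im r \<plusminus> 1.
      For even k the factors z = t + 1/2 and z - 1 = t - 1/2 add the pair (1/2, 0).\<close>
    define xs :: "(real \<times> real) list" where "xs = (if even k then [(1/2, 0)] else []) @ map (\<lambda>r. (1, Im r)) rs"
    have no: "poly (mellin_poly (Suc n)) z \<noteq> 0" if "Re z > 1/2" for z
    proof
      assume z: "poly (mellin_poly (Suc n)) z = 0"
      define t where "t = z - 1/2"
      define E F where "E = (\<Prod>(a, b)\<leftarrow>xs. t - \<i> * of_real b + of_real a)"
        and "F = (\<Prod>(a, b)\<leftarrow>xs. t - \<i> * of_real b - of_real a)"
      have maps: "map (\<lambda>r. z + 1 - r) rs = map (\<lambda>r. t - \<i> * of_real (Im r) + 1) rs"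
        "map (\<lambda>r. z - 1 - r) rs = map (\<lambda>r. t - \<i> * of_real (Im r) - 1) rs"
        by (rule map_cong[OF refl]; use re in \<open>force simp: t_def complex_eq_iff\<close>)+
      have E: "shift_factor k z * poly p (z + 1) = lead_coeff p * (if even k then 1 else 2) * E"
        and F: "shift_factor k (z - 1) * poly p (z - 1) = lead_coeff p * (if even k then 1 else 2) * F"
        unfolding ev maps E_def F_def xs_def
        by (cases "even k"; simp add: o_def shift_factor_def; simp add: t_def)+
      have "(of_real (real k + 2) - t) * (shift_factor k z * poly p (z + 1))
          + (of_real (real k + 2) + t) * (shift_factor k (z - 1) * poly p (z - 1)) = 0"
      proof -
        \<comment> \<open>The weights k + 2 - t on the forward and k + 2 + t on the backward
          recurrence cancel the terms in \<open>mellin_poly k\<close>.\<close>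
        have "2 * (of_nat k + 2) * poly (mellin_poly (Suc (Suc k))) z =
          (of_nat k + 2 - t) * (shift_factor k z * poly (mellin_poly (Suc k)) (z + 1))
          + (of_nat k + 2 + t) * (shift_factor k (z - 1) * poly (mellin_poly (Suc k)) (z - 1))"
          using mellin_poly_forward[of k z] mellin_poly_backward[of k z]
          unfolding t_def[symmetric] by algebra
        then show ?thesis using z by (simp add: p_def Suc)
      qed
      then have "(lead_coeff p * (if even k then 1 else 2)) *
        ((of_real (real k + 2) - t) * E + (of_real (real k + 2) + t) * F) = 0"
        unfolding E F by algebra
      then have "(of_real (real k + 2) - t) * E + (of_real (real k + 2) + t) * F = 0"
        using lc by (simp split: if_splits)
      moreover have "xs \<noteq> []"
      proof (cases "even k")
        case False
        then have "length rs > 0"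
          using rs(2) degree_lead_coeff_mellin_poly[of n] Suc False by (auto simp: p_def elim!: oddE)
        then show ?thesis by (auto simp: xs_def)
      qed (auto simp: xs_def)
      \<comment> \<open>The sum is (k + 1) / 2 in either parity; a cruder bound on the number of
        roots is enough.\<close>
      moreover have "(\<Sum>(a, b)\<leftarrow>xs. a) < real k + 2"
      proof -
        have "length rs = Suc k div 2"
          using rs(2) degree_lead_coeff_mellin_poly[of n] Suc by (simp add: p_def)
        then have "length rs \<le> Suc k" by simp
        then show ?thesis by (auto simp: xs_def o_def sum_list_triv)
      qed
      moreover have "Re t > 0" using that by (simp add: t_def)
      moreover have "a > 0" if "(a, b) \<in> set xs" for a b
        using that by (auto simp: xs_def split: if_splits)
      ultimately show False
        using shifted_product_no_zero[of xs t "real k + 2"] unfolding E_def F_def by blast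
    qed
    have "\<not> Re s > 1/2" using no Suc.prems by auto
    moreover have "\<not> Re s < 1/2"
      using no[of "1 - s"] Suc.prems by (auto simp: mellin_poly_functional_equation)
    ultimately show ?thesis by simp
  qed
qed

section \<open>The Mellin transform of the weight\<close>

definition neg_binomial_coeff :: "real \<Rightarrow> nat \<Rightarrow> real" where
  "neg_binomial_coeff c k = pochhammer c k / fact k"

lemma neg_binomial_coeff_nonneg: "c > 0 \<Longrightarrow> neg_binomial_coeff c k \<ge> 0"
  by (simp add: neg_binomial_coeff_def pochhammer_nonneg)

lemma neg_binomial_sums:
  assumes "0 \<le> x" "x < 1"
  shows "(\<lambda>k. neg_binomial_coeff c k * x ^ k) sums (1 - x) powr (- c)"
proof -
  have "((- c) gchoose k) * (- x) ^ k = neg_binomial_coeff c k * x ^ k" for k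
    by (simp add: neg_binomial_coeff_def gbinomial_pochhammer power_minus[of x])
  then show ?thesis using gen_binomial_real[of "- x" "- c"] assms by simp
qed

lemma
  fixes a :: real
  assumes "a > 0"
  shows set_integrable_powr_unit: "set_integrable lborel {0<..<1} (\<lambda>x. x powr (a - 1))"
    and set_integral_powr_unit: "(LBINT x:{0<..<1}. x powr (a - 1)) = 1 / a"
proof -
  \<comment> \<open>For a < 1 the integrand is unbounded near 0, but its antiderivative is
    continuous on the closed interval, so differentiability in the interior suffices.\<close>
  have "((\<lambda>x. x powr (a - 1)) has_integral (1 powr a / a - 0 powr a / a)) {0..1}"
  proof (rule fundamental_theorem_of_calculus_interior)
    show "continuous_on {0..1} (\<lambda>x. x powr a / a)"
      using assms by (intro continuous_on_divide continuous_on_powr' continuous_on_id continuous_on_const) auto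
    fix x :: real assume "x \<in> {0<..<1}"
    then show "((\<lambda>x. x powr a / a) has_vector_derivative x powr (a - 1)) (at x)"
      using DERIV_cdivide[OF has_real_derivative_powr[of x a], of a] assms
      by (simp add: has_real_derivative_iff_has_vector_derivative)
  qed (use assms in simp_all)
  then have hi: "((\<lambda>x. x powr (a - 1)) has_integral (1 / a)) {0<..<1}"
    using assms by (simp add: has_integral_Icc_iff_Ioo)
  then have "(\<lambda>x. x powr (a - 1)) absolutely_integrable_on {0<..<1}"
    by (subst absolutely_integrable_on_iff_nonneg) auto
  then show *: "set_integrable lborel {0<..<1} (\<lambda>x. x powr (a - 1))"
    unfolding set_integrable_def by (subst (asm) integrable_completion) auto
  show "(LBINT x:{0<..<1}. x powr (a - 1)) = 1 / a"
    using hi set_borel_integral_eq_integral(2)[OF *] by (simp add: integral_unique)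
qed

lemma
  fixes s :: complex
  assumes "Re s > 0"
  shows set_integrable_complex_powr_unit: "set_integrable lborel {0<..<1} (\<lambda>x. complex_of_real x powr (s - 1))"
    and set_integral_complex_powr_unit: "(LBINT x:{0<..<1}. complex_of_real x powr (s - 1)) = 1 / s"
proof -
  have i: "integrable lborel (\<lambda>x. indicator {0<..<1} x *\<^sub>R x powr (Re s - 1))"
    using set_integrable_powr_unit[OF assms] by (simp add: set_integrable_def)
  have m: "(\<lambda>x. indicator {0<..<1} x *\<^sub>R complex_of_real x powr (s - 1)) \<in> borel_measurable borel"
    by (intro borel_measurable_continuous_on_indicator continuous_on_powr_complex continuous_on_of_real
          continuous_on_id continuous_on_const) auto
  have n: "norm (indicator {0<..<1} x *\<^sub>R complex_of_real x powr (s - 1)) \<le>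
      norm (indicator {0<..<1} x *\<^sub>R x powr (Re s - 1))" for x :: real
    by (cases "x \<in> {0<..<1}") (simp_all add: norm_powr_real_powr)
  show *: "set_integrable lborel {0<..<1} (\<lambda>x. complex_of_real x powr (s - 1))"
    unfolding set_integrable_def
    by (rule Bochner_Integration.integrable_bound[OF i _ AE_I2[OF n]]) (use m in simp)
  have "((\<lambda>x. complex_of_real x powr (s - 1)) has_integral (of_real 1 powr s / s - of_real 0 powr s / s)) {0..1}"
    using assms
    by (intro fundamental_theorem_of_calculus_interior)
       (auto intro!: continuous_intros derivative_eq_intros has_vector_derivative_real_field)
  then have "((\<lambda>x. complex_of_real x powr (s - 1)) has_integral (1 / s)) {0<..<1}"
    by (simp add: has_integral_Icc_iff_Ioo)
  then show "(LBINT x:{0<..<1}. complex_of_real x powr (s - 1)) = 1 / s"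
    using set_borel_integral_eq_integral(2)[OF *] by (simp add: integral_unique)
qed

text \<open>Termwise integration of the binomial series of (1 - x^j)^(-c). The hypothesis
  \<open>sm\<close> says that the integrals of the norms are summable. The exponent j is 1 for the
  Beta function and 2 for the weight.\<close>

lemma
  fixes s :: complex and c :: real and j :: nat
  assumes s: "Re s > 0" and c: "0 < c" and j: "j > 0"
    and sm: "summable (\<lambda>k. neg_binomial_coeff c k / (Re s + real (j * k)))"
  shows set_integrable_powr_weight:
      "set_integrable lborel {0<..<1} (\<lambda>x. complex_of_real x powr (s - 1) / complex_of_real ((1 - x ^ j) powr c))"
    and set_integral_powr_weight:
      "(\<lambda>k. of_real (neg_binomial_coeff c k) / (s + of_nat (j * k))) sums
        (LBINT x:{0<..<1}. complex_of_real x powr (s - 1) / complex_of_real ((1 - x ^ j) powr c))"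
proof -
  define f :: "nat \<Rightarrow> real \<Rightarrow> complex" where
    "f k x = indicator {0<..<1} x *\<^sub>R (of_real (neg_binomial_coeff c k) * complex_of_real x powr (s + of_nat (j * k) - 1))" for k x
  have f: "f k x = (indicator {0<..<1} x *\<^sub>R complex_of_real x powr (s - 1)) * of_real (neg_binomial_coeff c k * (x ^ j) ^ k)" for k x
    by (auto simp: f_def indicator_def powr_add powr_diff powr_nat power_mult simp flip: of_nat_mult)
  have nf: "norm (f k x) = neg_binomial_coeff c k * (indicator {0<..<1} x *\<^sub>R x powr ((Re s + real (j * k)) - 1))" for k x
    using neg_binomial_coeff_nonneg[OF c, of k]
    by (auto simp: f_def indicator_def norm_mult norm_powr_real_powr)
  have fs: "(\<lambda>k. f k x) sums (indicator {0<..<1} x *\<^sub>R (complex_of_real x powr (s - 1) / complex_of_real ((1 - x ^ j) powr c)))" for x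
  proof (cases "x \<in> {0<..<1}")
    case True
    then have "0 \<le> x ^ j" "x ^ j < 1" using j by (auto simp: power_less_one_iff)
    from sums_mult[OF sums_of_real[OF neg_binomial_sums[OF this]], of "complex_of_real x powr (s - 1)" c]
    show ?thesis using True by (simp add: f powr_minus divide_simps)
  qed (simp add: f)
  have nfs: "summable (\<lambda>k. norm (f k x))" for x
  proof (cases "x \<in> {0<..<1}")
    case True
    then have "0 \<le> x ^ j" "x ^ j < 1" using j by (auto simp: power_less_one_iff)
    from summable_mult[OF sums_summable[OF neg_binomial_sums[OF this]], of "norm (complex_of_real x powr (s - 1))" c]
    show ?thesis using True neg_binomial_coeff_nonneg[OF c] by (simp add: f norm_mult norm_power abs_mult)
  qed (simp add: f)
  have I: "integrable lborel (f k)" "integral\<^sup>L lborel (f k) = of_real (neg_binomial_coeff c k) / (s + of_nat (j * k))" for k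
  proof -
    have pos: "Re (s + of_nat (j * k)) > 0" using s by (simp add: add_pos_nonneg del: of_nat_mult)
    show "integrable lborel (f k)"
      using set_integrable_complex_powr_unit[OF pos] unfolding f_def set_integrable_def
      by (simp add: mult_scaleR_right[symmetric] del: mult_scaleR_right of_nat_mult)
    show "integral\<^sup>L lborel (f k) = of_real (neg_binomial_coeff c k) / (s + of_nat (j * k))"
      using set_integral_complex_powr_unit[OF pos] unfolding f_def set_lebesgue_integral_def
      by (simp add: mult_scaleR_right[symmetric] del: mult_scaleR_right of_nat_mult)
  qed
  have "(\<integral>x. norm (f k x) \<partial>lborel) = neg_binomial_coeff c k / (Re s + real (j * k))" for k
  proof -
    have pos: "Re s + real (j * k) > 0" using s by (simp add: add_pos_nonneg del: of_nat_mult)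
    show ?thesis unfolding nf using set_integral_powr_unit[OF pos]
      by (simp add: set_lebesgue_integral_def del: of_nat_mult)
  qed
  then have S: "summable (\<lambda>k. \<integral>x. norm (f k x) \<partial>lborel)" using sm by simp
  have eq: "(\<lambda>x. \<Sum>k. f k x) = (\<lambda>x. indicator {0<..<1} x *\<^sub>R (complex_of_real x powr (s - 1) / complex_of_real ((1 - x ^ j) powr c)))"
    using sums_unique[OF fs] by (simp add: fun_eq_iff)
  show "set_integrable lborel {0<..<1} (\<lambda>x. complex_of_real x powr (s - 1) / complex_of_real ((1 - x ^ j) powr c))"
    using integrable_suminf[OF I(1) _ S] nfs unfolding set_integrable_def eq by simp
  show "(\<lambda>k. of_real (neg_binomial_coeff c k) / (s + of_nat (j * k))) sums
        (LBINT x:{0<..<1}. complex_of_real x powr (s - 1) / complex_of_real ((1 - x ^ j) powr c))"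
    using sums_integral[OF I(1) _ S] nfs unfolding set_lebesgue_integral_def eq I(2) by simp
qed

section \<open>The Beta function as a binomial series\<close>

text \<open>Partial sums are integrals of truncated binomial series, which are dominated by the real
  Beta integrand; the latter is integrable because c < 1.\<close>

lemma summable_neg_binomial_div:
  fixes a c :: real
  assumes a: "a > 0" and c: "0 < c" "c < 1"
  shows "summable (\<lambda>k. neg_binomial_coeff c k / (a + real k))"
proof (rule summableI_nonneg_bounded)
  show "0 \<le> neg_binomial_coeff c k / (a + real k)" for k
    using a neg_binomial_coeff_nonneg[OF c(1)] by simp
  fix N
  have "(\<Sum>k<N. neg_binomial_coeff c k / (a + real k)) =
    (\<Sum>k<N. \<integral>x. neg_binomial_coeff c k * (indicator {0<..<1} x *\<^sub>R x powr (a + real k - 1)) \<partial>lborel)"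
    using set_integral_powr_unit a by (intro sum.cong) (simp_all add: set_lebesgue_integral_def)
  also have "\<dots> = (\<integral>x. (\<Sum>k<N. neg_binomial_coeff c k * (indicator {0<..<1} x *\<^sub>R x powr (a + real k - 1))) \<partial>lborel)"
    using set_integrable_powr_unit a
    by (intro Bochner_Integration.integral_sum[symmetric] integrable_mult_right) (simp add: set_integrable_def)
  also have "\<dots> \<le> (\<integral>x. indicator {0..1} x *\<^sub>R (x powr (a - 1) * (1 - x) powr ((1 - c) - 1)) \<partial>lborel)"
  proof (rule integral_mono)
    show "integrable lborel (\<lambda>x. \<Sum>k<N. neg_binomial_coeff c k * (indicator {0<..<1} x *\<^sub>R x powr (a + real k - 1)))"
      using set_integrable_powr_unit a
      by (intro Bochner_Integration.integrable_sum integrable_mult_right) (simp add: set_integrable_def)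
    show "integrable lborel (\<lambda>x. indicator {0..1} x *\<^sub>R (x powr (a - 1) * (1 - x) powr ((1 - c) - 1)))"
      using integrable_Beta[of a "1 - c"] a c by (simp add: set_integrable_def)
    fix x :: real
    show "(\<Sum>k<N. neg_binomial_coeff c k * (indicator {0<..<1} x *\<^sub>R x powr (a + real k - 1)))
       \<le> indicator {0..1} x *\<^sub>R (x powr (a - 1) * (1 - x) powr ((1 - c) - 1))"
    proof (cases "x \<in> {0<..<1}")
      case True
      then have "(\<Sum>k<N. neg_binomial_coeff c k * x ^ k) \<le> (1 - x) powr (- c)"
        using neg_binomial_sums[of x c] neg_binomial_coeff_nonneg[OF c(1)]
        by (intro sum_le_suminf[THEN order_trans]) (auto simp: sums_iff)
      then have "x powr (a - 1) * (\<Sum>k<N. neg_binomial_coeff c k * x ^ k) \<le> x powr (a - 1) * (1 - x) powr (- c)"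
        by (intro mult_left_mono) auto
      also have "x powr (a - 1) * (\<Sum>k<N. neg_binomial_coeff c k * x ^ k) =
        (\<Sum>k<N. neg_binomial_coeff c k * (indicator {0<..<1} x *\<^sub>R x powr (a + real k - 1)))"
        using True by (simp add: sum_distrib_left powr_add powr_diff powr_realpow mult_ac)
      finally show ?thesis using True by simp
    qed (auto simp: indicator_def)
  qed
  finally show "(\<Sum>k<N. neg_binomial_coeff c k / (a + real k)) \<le>
    (\<integral>x. indicator {0..1} x *\<^sub>R (x powr (a - 1) * (1 - x) powr ((1 - c) - 1)) \<partial>lborel)" .
qed

lemma Beta_sums_real:
  fixes a c :: real
  assumes "a > 0" "0 < c" "c < 1"
  shows "(\<lambda>k. complex_of_real (neg_binomial_coeff c k) / (of_real a + of_nat k)) sums of_real (Beta a (1 - c))"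
proof -
  have sm: "summable (\<lambda>k. neg_binomial_coeff c k / (Re (of_real a) + real (1 * k)))"
    using summable_neg_binomial_div[OF assms] by simp
  have "((\<lambda>t. t powr (a - 1) * (1 - t) powr (1 - c - 1)) has_integral Beta a (1 - c)) {0<..<1}"
    using has_integral_Beta_real[of a "1 - c"] assms by (simp add: has_integral_Icc_iff_Ioo)
  then have "((\<lambda>t. complex_of_real (t powr (a - 1) * (1 - t) powr (1 - c - 1))) has_integral of_real (Beta a (1 - c))) {0<..<1}"
    by (rule has_integral_of_real)
  then have "((\<lambda>x. complex_of_real x powr (of_real a - 1) / complex_of_real ((1 - x ^ 1) powr c)) has_integral of_real (Beta a (1 - c))) {0<..<1}"
  proof (rule has_integral_eq[rotated])
    fix x :: real assume x: "x \<in> {0<..<1}"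
    then have "complex_of_real x powr (of_real a - 1) = of_real (x powr (a - 1))"
      using powr_of_real[of x "a - 1"] by simp
    then show "complex_of_real (x powr (a - 1) * (1 - x) powr (1 - c - 1)) =
        complex_of_real x powr (of_real a - 1) / complex_of_real ((1 - x ^ 1) powr c)"
      by (simp add: powr_minus divide_inverse)
  qed
  then have "(LBINT x:{0<..<1}. complex_of_real x powr (of_real a - 1) / complex_of_real ((1 - x ^ 1) powr c)) = of_real (Beta a (1 - c))"
    using set_borel_integral_eq_integral(2)[OF set_integrable_powr_weight[OF _ assms(2) _ sm]] assms(1)
    by (simp add: integral_unique)
  then show ?thesis
    using set_integral_powr_weight[OF _ assms(2) _ sm] assms(1) by simp
qed

text \<open>Both sides are holomorphic for Re z > 0 and agree on the positive reals, which
  accumulate at 1.\<close>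

lemma Beta_sums_complex:
  fixes z :: complex and c :: real
  assumes z: "Re z > 0" and c: "0 < c" "c < 1"
  shows "(\<lambda>k. of_real (neg_binomial_coeff c k) / (z + of_nat k)) sums Beta z (of_real (1 - c))"
proof -
  let ?S = "{z :: complex. Re z > 0}"
  let ?g = "\<lambda>k z. complex_of_real (neg_binomial_coeff c k) / (z + of_nat k)"
  define F where "F z = (\<Sum>k. ?g k z)" for z
  have S: "open ?S" "convex ?S" using open_halfspace_Re_gt convex_halfspace_Re_gt by auto
  have bound: "norm (?g k w) \<le> neg_binomial_coeff c k / (r + real k)" if "Re w \<ge> r" "r > 0" for k w r
  proof -
    have "r + real k \<le> norm (w + of_nat k)"
      using that complex_Re_le_cmod[of "w + of_nat k"] by simp
    then show ?thesis using neg_binomial_coeff_nonneg[OF c(1), of k] that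
      by (auto simp: norm_divide intro!: divide_left_mono mult_pos_pos)
  qed
  have hol: "F holomorphic_on ?S"
  proof (rule holomorphic_uniform_sequence[OF S(1)])
    show "(\<lambda>z. \<Sum>k<n. ?g k z) holomorphic_on ?S" for n
      by (intro holomorphic_intros) (auto simp: complex_eq_iff)
    fix w :: complex assume "w \<in> ?S"
    then have w: "Re w > 0" by simp
    \<comment> \<open>On this disc the series is dominated termwise by the convergent real series at
      Re w / 2, which gives local uniform convergence.\<close>
    have Re: "Re v \<ge> Re w / 2" if "v \<in> cball w (Re w / 2)" for v
      using that abs_Re_le_cmod[of "w - v"] by (simp add: dist_norm)
    have "uniform_limit (cball w (Re w / 2)) (\<lambda>n z. \<Sum>k<n. ?g k z) (\<lambda>z. \<Sum>k. ?g k z) sequentially"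
      using bound Re w
      by (intro Weierstrass_m_test[OF _ summable_neg_binomial_div[OF _ c, of "Re w / 2"]]) auto
    moreover have "cball w (Re w / 2) \<subseteq> ?S" using Re w by force
    ultimately show "\<exists>d>0. cball w d \<subseteq> ?S \<and> uniform_limit (cball w d) (\<lambda>n z. \<Sum>k<n. ?g k z) F sequentially"
      using w unfolding F_def by (intro exI[of _ "Re w / 2"]) auto
  qed
  have "F z - Beta z (of_real (1 - c)) = 0"
  proof (rule analytic_continuation[where f = "\<lambda>z. F z - Beta z (of_real (1 - c))" and S = ?S and U = "of_real ` {0<..}" and \<xi> = 1])
    show "(\<lambda>z. F z - Beta z (of_real (1 - c))) holomorphic_on ?S"
      unfolding Beta_altdef using hol
      by (intro holomorphic_intros) (auto elim!: nonpos_Ints_cases)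
    show "connected ?S" using S(2) convex_connected by blast
    show "1 islimpt complex_of_real ` {0<..}"
      unfolding islimpt_approachable
    proof (intro allI impI)
      fix e :: real assume "e > 0"
      then show "\<exists>x'\<in>complex_of_real ` {0<..}. x' \<noteq> 1 \<and> dist x' 1 < e"
        by (intro bexI[of _ "of_real (1 + e / 2)"] imageI) (simp_all add: dist_norm norm_divide)
    qed
    fix w assume "w \<in> complex_of_real ` {0<..}"
    then obtain a where a: "w = of_real a" "a > 0" by auto
    have "F w = of_real (Beta a (1 - c))"
      unfolding F_def a(1) using sums_unique[OF Beta_sums_real[OF a(2) c]] by simp
    then show "F w - Beta w (of_real (1 - c)) = 0"
      unfolding a(1) Beta_complex_of_real by simp
  qed (use S z in auto)
  moreover have "summable (\<lambda>k. ?g k z)"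
    using bound[of "Re z" z] z
    by (intro summable_comparison_test'[OF summable_neg_binomial_div[OF z c]]) auto
  ultimately show ?thesis by (simp add: F_def sums_iff)
qed

text \<open>The substitution u = x^2 carried out on the series: s + 2k = 2 (s/2 + k), so the case j
  = 2 is half the Beta series at s/2.\<close>

lemma
  fixes s :: complex and c :: real
  assumes s: "Re s > 0" and c: "0 < c" "c < 1"
  shows set_integrable_Mellin_weight:
      "set_integrable lborel {0<..<1} (\<lambda>x. complex_of_real x powr (s - 1) / complex_of_real ((1 - x\<^sup>2) powr c))"
    and set_integral_Mellin_weight:
      "(LBINT x:{0<..<1}. complex_of_real x powr (s - 1) / complex_of_real ((1 - x\<^sup>2) powr c))
          = Beta (s / 2) (of_real (1 - c)) / 2"
proof -
  have "neg_binomial_coeff c k / (Re s + real (2 * k)) = neg_binomial_coeff c k / (Re s / 2 + real k) / 2" for k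
    unfolding divide_divide_eq_left by (simp add: algebra_simps)
  then have sm: "summable (\<lambda>k. neg_binomial_coeff c k / (Re s + real (2 * k)))"
    using summable_neg_binomial_div[OF _ c, of "Re s / 2"] s by (simp only: summable_divide half_gt_zero)
  show "set_integrable lborel {0<..<1} (\<lambda>x. complex_of_real x powr (s - 1) / complex_of_real ((1 - x\<^sup>2) powr c))"
    using set_integrable_powr_weight[OF s c(1) _ sm] by simp
  have *: "(\<lambda>k. complex_of_real (neg_binomial_coeff c k) / (s / 2 + of_nat k) / 2) sums (Beta (s / 2) (of_real (1 - c)) / 2)"
    using s by (intro sums_divide Beta_sums_complex c) auto
  have **: "complex_of_real (neg_binomial_coeff c k) / (s / 2 + of_nat k) / 2 = of_real (neg_binomial_coeff c k) / (s + of_nat (2 * k))" for k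
    unfolding divide_divide_eq_left by (simp add: algebra_simps)
  show "(LBINT x:{0<..<1}. complex_of_real x powr (s - 1) / complex_of_real ((1 - x\<^sup>2) powr c))
          = Beta (s / 2) (of_real (1 - c)) / 2"
    using set_integral_powr_weight[OF s c(1) _ sm] *[unfolded **] by (intro sums_unique2) auto
qed

section \<open>The Mellin transform of the Chebyshev polynomials\<close>

text \<open>On the range of integration x is cos \<theta> with sin \<theta> nonzero, so the addition
  formulas give the three-term recurrence.\<close>

lemma
  fixes x :: real
  assumes "0 < x" "x < 1"
  shows poly_cheb_U_0: "poly (cheb_U 0) x = 1"
    and poly_cheb_U_1: "poly (cheb_U (Suc 0)) x = 2 * x"
    and poly_cheb_U_Suc_Suc:
      "poly (cheb_U (Suc (Suc n))) x = 2 * x * poly (cheb_U (Suc n)) x - poly (cheb_U n) x"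
proof -
  define \<theta> where "\<theta> = arccos x"
  have x: "x = cos \<theta>" and nz: "sin \<theta> \<noteq> 0"
    using assms by (simp_all add: \<theta>_def sin_arccos_nonzero)
  note U = poly_cheb_U[OF nz, folded x]
  show "poly (cheb_U 0) x = 1" using nz by (simp add: U)
  show "poly (cheb_U (Suc 0)) x = 2 * x" unfolding U using nz by (simp add: sin_double x)
  have "sin ((real (Suc (Suc n)) + 1) * \<theta>) = sin ((real (Suc n) + 1) * \<theta> + \<theta>)"
    "sin ((real n + 1) * \<theta>) = sin ((real (Suc n) + 1) * \<theta> - \<theta>)"
    by (simp_all add: algebra_simps)
  then have "sin ((real (Suc (Suc n)) + 1) * \<theta>) = 2 * x * sin ((real (Suc n) + 1) * \<theta>) - sin ((real n + 1) * \<theta>)"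
    by (simp only: sin_add sin_diff x) simp
  then show "poly (cheb_U (Suc (Suc n))) x = 2 * x * poly (cheb_U (Suc n)) x - poly (cheb_U n) x"
    unfolding U using nz by (simp add: diff_divide_distrib)
qed

text \<open>Multiplication by x shifts s to s + 1, since x^s = x x^(s-1).\<close>

lemma
  assumes "0 < x" "x < 1"
  shows mellin_integrand_0: "mellin_integrand 0 s x =
      complex_of_real x powr (s - 1) / complex_of_real ((1 - x\<^sup>2) powr (1/4))"
    and mellin_integrand_1: "mellin_integrand (Suc 0) s x = 2 * mellin_integrand 0 (s + 1) x"
    and mellin_integrand_Suc_Suc: "mellin_integrand (Suc (Suc n)) s x =
      2 * mellin_integrand (Suc n) (s + 1) x - mellin_integrand n s x"
proof -
  have p: "complex_of_real x powr s = of_real x * complex_of_real x powr (s - 1)"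
    using assms by (simp add: powr_diff)
  show "mellin_integrand 0 s x =
      complex_of_real x powr (s - 1) / complex_of_real ((1 - x\<^sup>2) powr (1/4))"
    using assms by (simp add: mellin_integrand_def poly_cheb_U_0)
  show "mellin_integrand (Suc 0) s x = 2 * mellin_integrand 0 (s + 1) x"
    using assms by (simp add: mellin_integrand_def poly_cheb_U_0 poly_cheb_U_1 p)
  show "mellin_integrand (Suc (Suc n)) s x =
      2 * mellin_integrand (Suc n) (s + 1) x - mellin_integrand n s x"
    using assms
    by (simp add: mellin_integrand_def poly_cheb_U_Suc_Suc p diff_divide_distrib right_diff_distrib)
qed

section \<open>Nonvanishing and shifts of the Gamma quotient\<close>

lemma Re_pos_not_nonpos_Ints: "Re z > 0 \<Longrightarrow> z \<notin> \<int>\<^sub>\<le>\<^sub>0"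
  by (auto elim!: nonpos_Ints_cases)

lemma Re_gamma_argument_pos:
  assumes "Re s > - real (parity n)"
  shows "Re (s / 2 + (2 * of_nat n + 3) / 4) > 0"
proof -
  have "(2 * of_nat n + 3) / 4 = complex_of_real ((2 * real n + 3) / 4)" by simp
  then have "Re (s / 2 + (2 * of_nat n + 3) / 4) = Re s / 2 + (2 * real n + 3) / 4"
    by (simp only: plus_complex.simps Re_complex_of_real) simp
  moreover have "real (parity n) \<le> 1" by (simp add: parity_def)
  ultimately show ?thesis using assms by (simp add: field_simps)
qed

lemma gamma_factor_nonzero:
  assumes "Re s > - real (parity n)"
  shows "gamma_factor n s \<noteq> 0"
proof -
  have "Re ((s + of_nat (parity n)) / 2) > 0" using assms by simp
  moreover have "Re (s / 2 + (2 * of_nat n + 3) / 4) > 0"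
    using Re_gamma_argument_pos[OF assms] .
  ultimately show ?thesis
    \<comment> \<open>\<open>Gamma\<close> has value 0 at its poles by convention, so a nonzero
      quotient requires both arguments to avoid the nonpositive integers.\<close>
    unfolding gamma_factor_def divide_eq_0_iff Gamma_eq_zero_iff
    using Re_pos_not_nonpos_Ints by blast
qed

text \<open>Brings all three terms of the Mellin recurrence to one Gamma quotient. The denominator
  argument w becomes w + 1 in both shifts; the numerator argument moves from s/2 to s/2 + 1 for even
  n and is unchanged for odd n.\<close>

lemma gamma_factor_shift:
  assumes "Re s > - real (parity n)"
  shows "gamma_factor n s = (s / 2 + (2 * of_nat n + 3) / 4) * gamma_factor (Suc (Suc n)) s"
    and "gamma_factor (Suc n) (s + 1) = (if even n then s / 2 else 1) * gamma_factor (Suc (Suc n)) s"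
proof -
  define w where "w = s / 2 + (2 * of_nat n + 3) / 4"
  have "Re w > 0"
    using Re_gamma_argument_pos[OF assms] by (simp only: w_def)
  then have w: "Gamma (w + 1) = w * Gamma w" "w \<noteq> 0"
    using Gamma_plus1[OF Re_pos_not_nonpos_Ints] by auto
  have w1: "s / 2 + (2 * of_nat (Suc (Suc n)) + 3) / 4 = w + 1"
    "(s + 1) / 2 + (2 * of_nat (Suc n) + 3) / 4 = w + 1"
    by (simp_all add: w_def field_simps)
  have p: "parity (Suc (Suc n)) = parity n" by (simp add: parity_def)
  show "gamma_factor n s = (s / 2 + (2 * of_nat n + 3) / 4) * gamma_factor (Suc (Suc n)) s"
    unfolding gamma_factor_def w1 p w(1) using w(2) by (simp add: w_def)
  show "gamma_factor (Suc n) (s + 1) = (if even n then s / 2 else 1) * gamma_factor (Suc (Suc n)) s"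
  proof (cases "even n")
    case True
    then have "Re (s / 2) > 0" using assms by (simp add: parity_def)
    then have "Gamma (s / 2 + 1) = s / 2 * Gamma (s / 2)"
      using Gamma_plus1[OF Re_pos_not_nonpos_Ints] by blast
    moreover have "(s + 1 + of_nat (parity (Suc n))) / 2 = s / 2 + 1"
      using True by (simp add: parity_def field_simps)
    ultimately have "Gamma ((s + 1 + of_nat (parity (Suc n))) / 2) = s / 2 * Gamma (s / 2)" by (simp only:)
    then show ?thesis
      unfolding gamma_factor_def w1 p by (simp only:) (use True in \<open>simp add: parity_def\<close>)
  next
    case False
    then show ?thesis
      unfolding gamma_factor_def w1 p by (simp add: parity_def)
  qed
qed

text \<open>M_0 is a Beta value, M_1(s) = 2 M_0(s + 1), and the rest follows by linearity from the
  recurrence of the integrands. Integrability belongs to the induction because linearity needs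
  it.\<close>

lemma mellin_integral:
  assumes "Re s > - real (parity n)"
  shows "set_integrable lborel {0<..<1} (mellin_integrand n s) \<and>
    mellin_U n s = poly (mellin_poly n) s * gamma_factor n s"
  using assms
proof (induction n arbitrary: s rule: less_induct)
  case (less n)
  have base: "set_integrable lborel {0<..<1} (mellin_integrand 0 s) \<and>
    mellin_U 0 s = poly (mellin_poly 0) s * gamma_factor 0 s" if s: "Re s > 0" for s
  proof -
    have c: "0 < (1/4 :: real)" "(1/4 :: real) < 1" by simp_all
    have "set_integrable lborel {0<..<1} (mellin_integrand 0 s)"
      using set_integrable_Mellin_weight[OF s c]
      by (rule set_integrable_cong[THEN iffD1, rotated -1]) (simp_all add: mellin_integrand_0)
    moreover have "mellin_U 0 s = Beta (s / 2) (of_real (1 - 1/4)) / 2"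
      unfolding mellin_U_def set_integral_Mellin_weight[OF s c, symmetric]
      by (rule set_lebesgue_integral_cong) (simp_all add: mellin_integrand_0)
    ultimately show ?thesis
      by (simp add: Beta_def gamma_factor_def parity_def mult_ac)
  qed
  consider "n = 0" | "n = 1" | k where "n = Suc (Suc k)"
    by (metis One_nat_def not0_implies_Suc)
  then show ?case
  proof cases
    case 1
    then show ?thesis using base less.prems by (simp add: parity_def)
  next
    case 2
    then have "Re (s + 1) > 0" using less.prems by (simp add: parity_def)
    note b = base[OF this]
    have "set_integrable lborel {0<..<1} (\<lambda>x. 2 * mellin_integrand 0 (s + 1) x)"
      using b by (intro set_integrable_mult_right) auto
    then have "set_integrable lborel {0<..<1} (mellin_integrand (Suc 0) s)"
      by (rule set_integrable_cong[THEN iffD1, rotated -1]) (simp_all add: mellin_integrand_1)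
    moreover have "mellin_U (Suc 0) s = (LBINT x:{0<..<1}. 2 * mellin_integrand 0 (s + 1) x)"
      unfolding mellin_U_def
      by (rule set_lebesgue_integral_cong) (simp_all add: mellin_integrand_1)
    then have "mellin_U (Suc 0) s = 2 * mellin_U 0 (s + 1)"
      by (simp add: mellin_U_def)
    moreover have "(s + 1) / 2 + 3 / 4 = s / 2 + 5 / 4" by (simp add: field_simps)
    ultimately show ?thesis
      using b 2 by (simp add: gamma_factor_def parity_def)
  next
    case 3
    \<comment> \<open>The shift to s + 1 stays in the half-plane of index \<open>Suc k\<close>,
      whose boundary moves by at most 1.\<close>
    have par: "parity n = parity k" "Re (s + 1) > - real (parity (Suc k))"
      using less.prems 3 by (auto simp: parity_def split: if_splits)
    have s: "Re s > - real (parity k)" using less.prems par by simp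
    note IH1 = less.IH[of "Suc k" "s + 1", unfolded 3, simplified, OF par(2)[simplified]]
      and IH2 = less.IH[of k s, unfolded 3, simplified, OF s]
    have i: "set_integrable lborel {0<..<1} (\<lambda>x. 2 * mellin_integrand (Suc k) (s + 1) x)"
      "set_integrable lborel {0<..<1} (mellin_integrand k s)"
      using IH1 IH2 by auto
    have "set_integrable lborel {0<..<1} (\<lambda>x. 2 * mellin_integrand (Suc k) (s + 1) x - mellin_integrand k s x)"
      using set_integral_diff(1)[OF i] .
    then have I: "set_integrable lborel {0<..<1} (mellin_integrand n s)"
      unfolding 3
      by (rule set_integrable_cong[THEN iffD1, rotated -1]) (simp_all add: mellin_integrand_Suc_Suc)
    have "mellin_U n s = (LBINT x:{0<..<1}. 2 * mellin_integrand (Suc k) (s + 1) x - mellin_integrand k s x)"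
      unfolding mellin_U_def 3
      by (rule set_lebesgue_integral_cong) (simp_all add: mellin_integrand_Suc_Suc)
    also have "\<dots> = 2 * mellin_U (Suc k) (s + 1) - mellin_U k s"
      unfolding set_integral_diff(2)[OF i] by (simp add: mellin_U_def)
    also have "\<dots> = (2 * (if even k then s / 2 else 1) * poly (mellin_poly (Suc k)) (s + 1)
      - (s / 2 + (2 * of_nat k + 3) / 4) * poly (mellin_poly k) s) * gamma_factor (Suc (Suc k)) s"
      unfolding conjunct2[OF IH1] conjunct2[OF IH2] gamma_factor_shift[OF s]
      by (simp add: algebra_simps)
    also have "2 * (if even k then s / 2 else 1) * poly (mellin_poly (Suc k)) (s + 1)
      - (s / 2 + (2 * of_nat k + 3) / 4) * poly (mellin_poly k) s = poly (mellin_poly n) s"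
      unfolding 3 by (cases "even k") (simp_all add: mellin_poly_even_step mellin_poly_odd_step field_simps)
    finally show ?thesis using I 3 by simp
  qed
qed

text \<open>A competing entire function agrees with the polynomial on the half-plane, where
  \<open>gamma_factor\<close> can be cancelled, and hence everywhere by the identity
  theorem.\<close>

lemma mellin_p_eq: "mellin_p n = poly (mellin_poly n)"
  unfolding mellin_p_def
proof (rule the_equality)
  show "poly (mellin_poly n) holomorphic_on UNIV \<and>
    (\<forall>s. Re s > - real (parity n) \<longrightarrow> mellin_U n s = poly (mellin_poly n) s * gamma_factor n s)"
    using mellin_integral by (auto intro: holomorphic_intros)
  fix f assume f: "f holomorphic_on UNIV \<and>
    (\<forall>s. Re s > - real (parity n) \<longrightarrow> mellin_U n s = f s * gamma_factor n s)"
  show "f = poly (mellin_poly n)"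
  proof
    fix z
    show "f z = poly (mellin_poly n) z"
    proof (rule analytic_continuation_open[where f = f and s = "{s. Re s > - real (parity n)}" and s' = UNIV])
      show "open {s. Re s > - real (parity n)}" by (rule open_halfspace_Re_gt)
      have "1 \<in> {s. Re s > - real (parity n)}" by simp
      then show "{s. Re s > - real (parity n)} \<noteq> {}" by blast
      show "f w = poly (mellin_poly n) w" if "w \<in> {s. Re s > - real (parity n)}" for w
        using that f mellin_integral[of n w] gamma_factor_nonzero[of n w] by auto
    qed (use f in \<open>auto intro: holomorphic_intros\<close>)
  qed
qed

section \<open>Recurrence, degree, symmetry and zeros of p_n\<close>

theorem theorem1:
  shows
    "(\<forall>n. mellin_p n holomorphic_on UNIV \<and>
        (\<forall>s. Re s > - real (parity n) \<longrightarrow>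
           set_integrable lborel {0<..<1} (mellin_integrand n s) \<and>
           mellin_U n s = mellin_p n s * gamma_factor n s)) \<and>
     (\<forall>s. mellin_p 0 s = Gamma (3/4) / 2) \<and>
     (\<forall>s. mellin_p 1 s = Gamma (3/4)) \<and>
     (\<forall>n s. n \<ge> 2 \<and> even n \<longrightarrow>
        mellin_p n s = s * mellin_p (n - 1) (s + 1)
                       - 1/2 * (s + of_nat n - 1/2) * mellin_p (n - 2) s) \<and>
     (\<forall>n s. n \<ge> 3 \<and> odd n \<longrightarrow>
        mellin_p n s = 2 * mellin_p (n - 1) (s + 1)
                       - 1/2 * (s + of_nat n - 1/2) * mellin_p (n - 2) s) \<and>
     (\<forall>n. \<exists>q :: complex poly.
        (\<forall>s. mellin_p n s = poly q s) \<and>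
        degree q = n div 2 \<and>
        (\<forall>s. mellin_p n s = (-1) ^ (n div 2) * mellin_p n (1 - s)) \<and>
        (\<forall>s. mellin_p n s = 0 \<longrightarrow> Re s = 1/2) \<and>
        (\<forall>s. mellin_p n s = 0 \<and> s \<noteq> 1/2 \<longrightarrow>
           mellin_p n (cnj s) = 0 \<and> cnj s \<noteq> s \<and> order (cnj s) q = order s q))"
proof (intro conjI allI impI; (elim conjE)?)
  fix n and s :: complex
  assume s: "Re s > - real (parity n)"
  show "set_integrable lborel {0<..<1} (mellin_integrand n s)"
    "mellin_U n s = mellin_p n s * gamma_factor n s"
    using mellin_integral[OF s] by (simp_all add: mellin_p_eq)
next
  show "mellin_p n holomorphic_on UNIV" for n
    unfolding mellin_p_eq by (auto intro: holomorphic_intros)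
  show "mellin_p 0 s = Gamma (3/4) / 2" "mellin_p 1 s = Gamma (3/4)" for s
    by (simp_all add: mellin_p_eq)
next
  fix n :: nat and s :: complex
  assume n: "n \<ge> 2" "even n"
  obtain k where k: "n = Suc (Suc k)" using n(1) by (metis add_2_eq_Suc le_Suc_ex)
  show "mellin_p n s = s * mellin_p (n - 1) (s + 1) - 1/2 * (s + of_nat n - 1/2) * mellin_p (n - 2) s"
    using mellin_poly_even_step[of k s] n(2) by (simp add: mellin_p_eq k algebra_simps)
next
  fix n :: nat and s :: complex
  assume n: "n \<ge> 3" "odd n"
  obtain k where k: "n = Suc (Suc k)" using n(1) by (metis add_2_eq_Suc le_Suc_ex numeral_3_eq_3 Suc_leD numeral_2_eq_2)
  show "mellin_p n s = 2 * mellin_p (n - 1) (s + 1) - 1/2 * (s + of_nat n - 1/2) * mellin_p (n - 2) s"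
    using mellin_poly_odd_step[of k s] n(2) by (simp add: mellin_p_eq k algebra_simps)
next
  fix n :: nat
  have fe: "poly (mellin_poly n) s = (-1) ^ (n div 2) * poly (mellin_poly n) (1 - s)" for s
    using mellin_poly_functional_equation[of n "1 - s"] by simp
  have sym: "poly (mellin_poly n) (cnj s) = 0 \<and> cnj s \<noteq> s \<and>
      order (cnj s) (mellin_poly n) = order s (mellin_poly n)"
    if "poly (mellin_poly n) s = 0" "s \<noteq> 1/2" for s
  proof -
    have re: "Re s = 1/2" using mellin_poly_zeros[OF that(1)] .
    \<comment> \<open>On the critical line conjugation is the reflection s -> 1 - s, so the
      functional equation supplies the conjugate zero together with its multiplicity.\<close>
    then have "cnj s = 1 - s" by (simp add: complex_eq_iff)
    moreover have "cnj s \<noteq> s" using that(2) re by (auto simp: complex_eq_iff)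
    ultimately show ?thesis
      using that(1) by (simp add: mellin_poly_functional_equation order_mellin_poly_reflect)
  qed
  show "\<exists>q :: complex poly.
        (\<forall>s. mellin_p n s = poly q s) \<and>
        degree q = n div 2 \<and>
        (\<forall>s. mellin_p n s = (-1) ^ (n div 2) * mellin_p n (1 - s)) \<and>
        (\<forall>s. mellin_p n s = 0 \<longrightarrow> Re s = 1/2) \<and>
        (\<forall>s. mellin_p n s = 0 \<and> s \<noteq> 1/2 \<longrightarrow>
           mellin_p n (cnj s) = 0 \<and> cnj s \<noteq> s \<and> order (cnj s) q = order s q)"
    unfolding mellin_p_eq
    using degree_lead_coeff_mellin_poly[of n] fe mellin_poly_zeros sym
    by (intro exI[of _ "mellin_poly n"]) blast
qed

end
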